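(* Let $g(z)=\sum_{n=0}^{\infty} g_n z^n$ be a power series converging for $|z|<R$, where $R>1$. For an integer $\ell\ge 0$ put $g_\ell(z)=\sum_{n=0}^{\infty} g_{n+\ell}z^n$. Let $k\ge 1$ and $\ell\ge 0$ be integers, let $x_1,\ldots,x_k$ be pairwise different (real or complex) numbers with $|x_i|<R$ for all $i$, and define $$G_{k,\ell}(x_1,\ldots,x_k)=\sum_{n_1=0}^{\infty}\cdots\sum_{n_k=0}^{\infty} g_{n_1+\cdots+n_k+\ell}\; x_1^{n_1}\cdots x_k^{n_k}.$$ Then $$G_{k,\ell}(x_1,\ldots,x_k)=\left[x_1,\ldots,x_k;\, z^{k-1}g_\ell(z)\right],$$ the divided difference of the function $z\mapsto z^{k-1}g_\ell(z)$ at the knots $x_1,\ldots,x_k$.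
   Context: For pairwise different real or complex numbers $x_0,\ldots,x_m$, the divided differences of a function $f$ are defined recursively by $[x_0;f]=f(x_0)$ and $$[x_0,\ldots,x_m;f]=\frac{[x_1,\ldots,x_m;f]-[x_0,\ldots,x_{m-1};f]}{x_m-x_0}.$$ The notation $[x_1,\ldots,x_k;\,h(z)]$ means the divided difference of the function $z\mapsto h(z)$. *)

theory Defs
  imports "HOL-Analysis.Analysis"
begin

text \<open>The divided difference \<open>[x\<^sub>0, \<dots>, x\<^sub>m; f]\<close>. The value at the empty list of knots
  is a dummy.\<close>

fun divided_difference :: "'a::field list \<Rightarrow> ('a \<Rightarrow> 'a) \<Rightarrow> 'a" where
  "divided_difference [] f = 0"
| "divided_difference [x] f = f x"
| "divided_difference (x # y # zs) f =
     (divided_difference (y # zs) f - divided_difference (butlast (x # y # zs)) f)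
       / (last (y # zs) - x)"

text \<open>\<open>nested_sum k F\<close> is the iterated series
  \<open>\<Sum>n\<^sub>1. \<Sum>n\<^sub>2. \<dots> \<Sum>n\<^sub>k. F [n\<^sub>1, n\<^sub>2, \<dots>, n\<^sub>k]\<close>. As \<^const>\<open>suminf\<close> is unspecified on divergent
  series, \<open>nested_summable k F\<close> records that every series occurring in it, at each level
  and for all values of the outer indices, converges.\<close>

primrec nested_sum :: "nat \<Rightarrow> (nat list \<Rightarrow> 'a::real_normed_vector) \<Rightarrow> 'a" where
  "nested_sum 0 F = F []"
| "nested_sum (Suc k) F = (\<Sum>n. nested_sum k (\<lambda>ns. F (n # ns)))"

primrec nested_summable :: "nat \<Rightarrow> (nat list \<Rightarrow> 'a::real_normed_vector) \<Rightarrow> bool" where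
  "nested_summable 0 F \<longleftrightarrow> True"
| "nested_summable (Suc k) F \<longleftrightarrow>
     (\<forall>n. nested_summable k (\<lambda>ns. F (n # ns))) \<and>
     summable (\<lambda>n. nested_sum k (\<lambda>ns. F (n # ns)))"

definition shifted_series :: "(nat \<Rightarrow> 'a::real_normed_field) \<Rightarrow> nat \<Rightarrow> 'a \<Rightarrow> 'a" where
  "shifted_series g l z = (\<Sum>n. g (n + l) * z ^ n)"

definition G_term :: "(nat \<Rightarrow> 'a::real_normed_field) \<Rightarrow> nat \<Rightarrow> 'a list \<Rightarrow> nat list \<Rightarrow> 'a" where
  "G_term g l xs ns = g (sum_list ns + l) * (\<Prod>i<length xs. (xs ! i) ^ (ns ! i))"

definition G :: "(nat \<Rightarrow> 'a::real_normed_field) \<Rightarrow> nat \<Rightarrow> nat \<Rightarrow> 'a list \<Rightarrow> 'a" where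
  "G g k l xs = nested_sum k (G_term g l xs)"

end

(* Summing over n_1 last, the inner sums are G_{k-1,n_1+l}(x_2, ..., x_k), so one inducts on k.
   The divided difference is a fixed linear combination of point evaluations (Lagrange form), hence
   the outer series reduces to the case of two knots,
     \<Sum>n x^n g_{n+l}(y) = (x g_l(x) - y g_l(y)) / (x - y),
   which telescopes because g_l(y) = g_l + y g_{l+1}(y).  The terms that contain g_l(x_1) are collected
   by the fact that the divided difference of z^{k-2} at k knots vanishes. *)
theory Submission
  imports Defs
begin

section \<open>Divided differences in Lagrange form, over a set of knots\<close>

definition lagrange_sum :: "'a::field set \<Rightarrow> ('a \<Rightarrow> 'a) \<Rightarrow> 'a" where
  "lagrange_sum A f = (\<Sum>x\<in>A. f x / (\<Prod>y\<in>A - {x}. x - y))"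

lemma lagrange_sum_cong:
  "(\<And>x. x \<in> A \<Longrightarrow> f x = h x) \<Longrightarrow> lagrange_sum A f = lagrange_sum A h"
  by (simp add: lagrange_sum_def)

lemma lagrange_sum_add:
  "lagrange_sum A (\<lambda>x. f x + h x) = lagrange_sum A f + lagrange_sum A h"
  by (simp add: lagrange_sum_def add_divide_distrib sum.distrib)

lemma lagrange_sum_mult_left:
  "lagrange_sum A (\<lambda>x. c * f x) = c * lagrange_sum A f"
  by (simp add: lagrange_sum_def sum_distrib_left)

lemma lagrange_sum_insert:
  assumes "finite A" "a \<notin> A"
  shows "lagrange_sum (insert a A) f =
           f a / (\<Prod>y\<in>A. a - y) + lagrange_sum A (\<lambda>x. f x / (x - a))"
proof -
  have "(\<Prod>y\<in>insert a A - {x}. x - y) = (x - a) * (\<Prod>y\<in>A - {x}. x - y)" if "x \<in> A" for x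
  proof -
    have "insert a A - {x} = insert a (A - {x})"
      using that assms by auto
    then show ?thesis
      using assms by simp
  qed
  then show ?thesis
    using assms by (simp add: lagrange_sum_def)
qed

text \<open>The factor \<open>x - a\<close> kills the term at \<open>a\<close> and cancels the
  factor that \<open>a\<close> contributes to every other denominator, so this knot drops
  out.\<close>

lemma lagrange_sum_insert_diff_mult:
  assumes "finite A" "a \<notin> A"
  shows "lagrange_sum (insert a A) (\<lambda>x. (x - a) * f x) = lagrange_sum A f"
  using assms by (auto simp: lagrange_sum_insert intro!: lagrange_sum_cong)

text \<open>The factors \<open>x - a\<close> and \<open>x - b\<close> each remove one knot, and they
  differ by the constant \<open>b - a\<close>. This is the recursion of divided differences in a
  form free of any order of the knots.\<close>

lemma lagrange_sum_insert_insert: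
  assumes "finite A" "a \<notin> A" "b \<notin> A" "a \<noteq> b"
  shows "(lagrange_sum (insert b A) f - lagrange_sum (insert a A) f) / (b - a) =
           lagrange_sum (insert a (insert b A)) f"
proof -
  let ?L = "lagrange_sum (insert a (insert b A))"
  have 1: "lagrange_sum (insert b A) f = ?L (\<lambda>x. (x - a) * f x)"
    using lagrange_sum_insert_diff_mult[of "insert b A" a f] assms by simp
  have 2: "lagrange_sum (insert a A) f = ?L (\<lambda>x. (x - b) * f x)"
    using lagrange_sum_insert_diff_mult[of "insert a A" b f] assms by (simp add: insert_commute)
  have "?L (\<lambda>x. (x - a) * f x) = ?L (\<lambda>x. (x - b) * f x + (b - a) * f x)"
    by (rule lagrange_sum_cong) (simp add: algebra_simps)
  then have "?L (\<lambda>x. (x - a) * f x) = ?L (\<lambda>x. (x - b) * f x) + (b - a) * ?L f"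
    by (simp only: lagrange_sum_add lagrange_sum_mult_left)
  then show ?thesis
    using assms 1 2 by simp
qed

lemma divided_difference_eq_lagrange_sum:
  "distinct xs \<Longrightarrow> divided_difference xs f = lagrange_sum (set xs) f"
proof (induction xs f rule: divided_difference.induct)
  case (1 f)
  then show ?case by (simp add: lagrange_sum_def)
next
  case (2 x f)
  then show ?case by (simp add: lagrange_sum_def)
next
  case (3 x y zs f)
  \<comment> \<open>Splitting off the last knot \<open>w\<close> exhibits \<open>ws\<close> as the
    knots common to both differences in the recursion; \<open>x\<close> and \<open>w\<close> are the
    two knots dropped in turn.\<close>
  obtain ws w where ws: "y # zs = ws @ [w]"
    by (metis list.distinct(1) rev_exhaust)
  then have last_butlast: "last (y # zs) = w" "butlast (x # y # zs) = x # ws"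
    by (simp_all add: butlast_append)
  have "divided_difference (x # y # zs) f =
      (divided_difference (ws @ [w]) f - divided_difference (x # ws) f) / (w - x)"
    unfolding divided_difference.simps last_butlast unfolding ws ..
  also have "\<dots> = (lagrange_sum (set (ws @ [w])) f - lagrange_sum (set (x # ws)) f) / (w - x)"
    using 3 unfolding last_butlast ws by simp
  also have "\<dots> = lagrange_sum (set (x # y # zs)) f"
    using 3(3) lagrange_sum_insert_insert[of "set ws" x w f] unfolding ws by simp
  finally show ?case .
qed

text \<open>Two knots give \<open>c - c\<close> in the numerator; for longer lists both shorter
  differences vanish. Repeated knots do no harm, since \<open>0 / 0 = 0\<close>.\<close>

lemma divided_difference_const:
  "length xs \<ge> 2 \<Longrightarrow> divided_difference xs (\<lambda>_. c) = 0"
proof (induction xs "\<lambda>_::'a. c" rule: divided_difference.induct)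
  case (3 x y zs)
  show ?case
  proof (cases zs)
    case Nil
    then show ?thesis
      by simp
  next
    case (Cons z ws)
    have "divided_difference (y # zs) (\<lambda>_. c) = 0"
      by (rule 3(1)) (simp add: Cons)
    moreover have "divided_difference (butlast (x # y # zs)) (\<lambda>_. c) = 0"
      by (rule 3(2)) (simp add: Cons)
    ultimately show ?thesis
      unfolding divided_difference.simps by (metis diff_self div_0)
  qed
qed simp_all

lemma lagrange_sum_const:
  assumes "finite A" "card A \<ge> 2"
  shows "lagrange_sum A (\<lambda>_. c) = 0"
proof -
  obtain xs where "set xs = A" "distinct xs"
    using finite_distinct_list[OF assms(1)] by blast
  then show ?thesis
    using assms(2) divided_difference_const[of xs c]
      divided_difference_eq_lagrange_sum[of xs "\<lambda>_. c"] distinct_card[of xs] by simp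
qed

text \<open>Splitting \<open>x ^ Suc m\<close> as \<open>(x - a) * x ^ m + a * x ^ m\<close> lowers
  the degree by one, while the first summand costs only the knot \<open>a\<close>. Hence the
  induction hypothesis covers both summands.\<close>

lemma lagrange_sum_power_eq_0:
  assumes "finite A" "m + 1 < card A"
  shows "lagrange_sum A (\<lambda>x. x ^ m) = 0"
  using assms
proof (induction m arbitrary: A)
  case 0
  then show ?case by (simp add: lagrange_sum_const)
next
  case (Suc m)
  from Suc.prems have "A \<noteq> {}"
    by auto
  then obtain a B where B: "A = insert a B" "a \<notin> B"
    by (meson ex_in_conv mk_disjoint_insert)
  with Suc.prems have "finite B"
    by simp
  have "lagrange_sum A (\<lambda>x. x ^ Suc m) = lagrange_sum A (\<lambda>x. (x - a) * x ^ m + a * x ^ m)"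
    by (rule lagrange_sum_cong) (simp add: algebra_simps)
  also have "\<dots> = lagrange_sum B (\<lambda>x. x ^ m) + a * lagrange_sum A (\<lambda>x. x ^ m)"
    using B \<open>finite B\<close>
    by (simp add: lagrange_sum_add lagrange_sum_mult_left lagrange_sum_insert_diff_mult
        del: mult_eq_0_iff)
  also have "\<dots> = 0"
    using Suc.IH[of A] Suc.IH[of B] Suc.prems B \<open>finite B\<close> by simp
  finally show ?case .
qed

text \<open>The divided difference side of the induction on the number of knots: the new knot
  \<open>a\<close> is absorbed into a difference quotient of \<open>z * F z\<close>.\<close>

lemma lagrange_sum_insert_power_mult:
  fixes F :: "'a::field \<Rightarrow> 'a"
  assumes "finite A" "a \<notin> A" "card A = Suc m"
  shows "lagrange_sum (insert a A) (\<lambda>z. z ^ Suc m * F z) =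
           lagrange_sum A (\<lambda>z. z ^ m * ((a * F a - z * F z) / (a - z)))"
proof -
  let ?P = "\<Prod>y\<in>A. a - y"
  \<comment> \<open>There are \<open>m + 2\<close> knots, just enough for \<open>z ^ m\<close> to be
    annihilated. Solving for the weight at \<open>a\<close> lets \<open>a * F a\<close> be
    distributed over the knots in \<open>A\<close>.\<close>
  have "lagrange_sum (insert a A) (\<lambda>z. z ^ m) = 0"
    using assms by (intro lagrange_sum_power_eq_0) auto
  then have 1: "a ^ m / ?P = - lagrange_sum A (\<lambda>z. z ^ m / (z - a))"
    using assms by (simp add: lagrange_sum_insert add_eq_0_iff2)
  have "lagrange_sum (insert a A) (\<lambda>z. z ^ Suc m * F z) =
          a * F a * (a ^ m / ?P) + lagrange_sum A (\<lambda>z. z ^ Suc m * F z / (z - a))"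
    using assms by (simp add: lagrange_sum_insert)
  also have "\<dots> = lagrange_sum A (\<lambda>z. (- (a * F a)) * (z ^ m / (z - a)) + z ^ Suc m * F z / (z - a))"
    unfolding 1 lagrange_sum_add lagrange_sum_mult_left by simp
  also have "\<dots> = lagrange_sum A (\<lambda>z. z ^ m * ((a * F a - z * F z) / (a - z)))"
  proof (rule lagrange_sum_cong)
    fix z assume "z \<in> A"
    then have "z - a \<noteq> 0" "a - z \<noteq> 0" using assms by auto
    then show "(- (a * F a)) * (z ^ m / (z - a)) + z ^ Suc m * F z / (z - a) =
        z ^ m * ((a * F a - z * F z) / (a - z))"
      by (simp add: divide_simps) (simp add: algebra_simps)
  qed
  finally show ?thesis .
qed

section \<open>Shifted power series: convergence, bounds and the case of two knots\<close>

lemma sums_lagrange_sum: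
  fixes f :: "nat \<Rightarrow> 'a::real_normed_field \<Rightarrow> 'a"
  assumes "\<And>x. x \<in> A \<Longrightarrow> (\<lambda>n. f n x) sums s x"
  shows "(\<lambda>n. lagrange_sum A (f n)) sums lagrange_sum A s"
  unfolding lagrange_sum_def by (intro sums_sum sums_divide assms)

text \<open>Comparison with a geometric series of ratio \<open>norm x / r\<close>. The decay
  \<open>1 / r ^ l\<close> in the shift is what makes the outer series, which runs over the shift,
  converge.\<close>

lemma shifted_series_bound:
  fixes g :: "nat \<Rightarrow> 'a::{real_normed_field, banach}"
  assumes "norm x < r" and bound: "\<And>n. norm (g n) * r ^ n \<le> C"
  shows "summable (\<lambda>n. g (n + l) * x ^ n)"
    and "norm (shifted_series g l x) \<le> C / (1 - norm x / r) / r ^ l"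
proof -
  have r: "r > 0"
    using assms(1) norm_ge_zero[of x] by linarith
  have le: "norm (g (n + l) * x ^ n) \<le> C / r ^ l * (norm x / r) ^ n" for n
  proof -
    have "norm (g (n + l)) \<le> C / r ^ (n + l)"
      using bound[of "n + l"] r by (simp add: pos_le_divide_eq)
    then have "norm (g (n + l)) * norm x ^ n \<le> C / r ^ (n + l) * norm x ^ n"
      by (intro mult_right_mono) auto
    then show ?thesis
      by (simp add: norm_mult norm_power power_add power_divide mult_ac)
  qed
  have sums: "(\<lambda>n. C / r ^ l * (norm x / r) ^ n) sums (C / r ^ l * (1 / (1 - norm x / r)))"
    using r assms(1) by (intro sums_mult geometric_sums) auto
  then show "summable (\<lambda>n. g (n + l) * x ^ n)"
    using le by (blast intro: sums_summable summable_comparison_test')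
  show "norm (shifted_series g l x) \<le> C / (1 - norm x / r) / r ^ l"
    unfolding shifted_series_def
    using norm_suminf_le[OF le sums_summable[OF sums]] sums_unique[OF sums] by (simp add: mult_ac)
qed

context
  fixes g :: "nat \<Rightarrow> 'a::{real_normed_field, banach}" and R :: real
  assumes conv: "\<And>z. norm z < R \<Longrightarrow> summable (\<lambda>n. g n * z ^ n)"
begin

lemma coefficient_bound:
  assumes "0 < r" "r < R"
  obtains C where "\<And>n. norm (g n) * r ^ n \<le> C"
proof -
  have "summable (\<lambda>n. g n * of_real r ^ n)"
    using assms by (intro conv) simp
  then obtain C where "\<And>n. norm (g n * of_real r ^ n) \<le> C"
    using summable_imp_Bseq BseqE by blast
  then have "\<And>n. norm (g n) * r ^ n \<le> C"
    using assms by (simp add: norm_mult norm_power)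
  then show ?thesis ..
qed

lemma shifted_series_sums:
  assumes "norm x < R"
  shows "(\<lambda>n. g (n + l) * x ^ n) sums shifted_series g l x"
proof -
  obtain r where r: "norm x < r" "r < R"
    using dense[OF assms] by blast
  moreover from r have "0 < r"
    using norm_ge_zero[of x] by linarith
  ultimately obtain C where "\<And>n. norm (g n) * r ^ n \<le> C"
    using coefficient_bound by blast
  then show ?thesis
    unfolding shifted_series_def using shifted_series_bound(1) r(1) by (blast intro: summable_sums)
qed

lemma shifted_series_Suc:
  assumes "norm x < R"
  shows "shifted_series g l x = g l + x * shifted_series g (Suc l) x"
proof -
  have "(\<lambda>n. g (Suc n + l) * x ^ Suc n) sums (x * shifted_series g (Suc l) x)"
    using sums_mult[OF shifted_series_sums[OF assms, of "Suc l"], of x] by (simp add: mult_ac)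
  then have "(\<lambda>n. g (n + l) * x ^ n) sums (x * shifted_series g (Suc l) x + g (0 + l) * x ^ 0)"
    by (rule sums_Suc)
  then show ?thesis
    using sums_unique2[OF shifted_series_sums[OF assms, of l]] by simp
qed

lemma sums_power_mult_shifted_series:
  assumes x: "norm x < R" and y: "norm y < R" and "x \<noteq> y"
  shows "(\<lambda>n. x ^ n * shifted_series g (n + l) y) sums
           ((x * shifted_series g l x - y * shifted_series g l y) / (x - y))"
proof -
  define s where "s n = x ^ n * shifted_series g (n + l) y" for n
  \<comment> \<open>One radius serves both points: \<open>norm y < r\<close> bounds the shifted
    series, and \<open>norm x < r\<close> gives a geometric majorant of ratio below 1.\<close>
  obtain r where r: "max (norm x) (norm y) < r" "r < R"
    using dense[of "max (norm x) (norm y)" R] x y by auto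
  have r0: "r > 0"
    using r norm_ge_zero[of x] by linarith
  obtain C where C: "\<And>n. norm (g n) * r ^ n \<le> C"
    using coefficient_bound[OF r0 r(2)] by blast
  define D where "D = C / (1 - norm y / r) / r ^ l"
  have "norm (s n) \<le> D * (norm x / r) ^ n" for n
  proof -
    have "norm (s n) \<le> norm x ^ n * (C / (1 - norm y / r) / r ^ (n + l))"
      unfolding s_def norm_mult norm_power
      using r C by (intro mult_left_mono shifted_series_bound) auto
    then show ?thesis
      by (simp add: D_def power_add power_divide mult_ac)
  qed
  moreover have "summable (\<lambda>n. D * (norm x / r) ^ n)"
    using r r0 by (intro summable_mult summable_geometric) auto
  ultimately have "summable s"
    by (intro summable_comparison_test'[of "\<lambda>n. D * (norm x / r) ^ n" 0 s]) auto
  then obtain S where S: "s sums S"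
    by blast
  have "(\<lambda>n. s (Suc n)) sums (S - s 0)"
    using S sums_Suc_iff[of s "S - s 0"] by simp
  then have "(\<lambda>n. x * s n - y * s (Suc n)) sums (x * S - y * (S - s 0))"
    using S by (intro sums_diff sums_mult)
  \<comment> \<open>This is the recurrence in the shift at \<open>y\<close>, multiplied by
    \<open>x ^ Suc n\<close>; the values at \<open>y\<close> cancel and only a term of the series at
    \<open>x\<close> remains.\<close>
  moreover have "x * s n - y * s (Suc n) = x * (g (n + l) * x ^ n)" for n
    using shifted_series_Suc[OF y, of "n + l"] by (simp add: s_def algebra_simps)
  moreover have "(\<lambda>n. x * (g (n + l) * x ^ n)) sums (x * shifted_series g l x)"
    by (intro sums_mult shifted_series_sums x)
  ultimately have "x * shifted_series g l x = x * S - y * (S - s 0)"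
    using sums_unique2 by simp
  \<comment> \<open>Since \<open>s 0\<close> is \<open>shifted_series g l y\<close>, the two
    evaluations of the series give a linear equation for \<open>S\<close>.\<close>
  then have "x * shifted_series g l x - y * shifted_series g l y = (x - y) * S"
    by (simp add: s_def algebra_simps)
  then have "S = (x * shifted_series g l x - y * shifted_series g l y) / (x - y)"
    using \<open>x \<noteq> y\<close> by simp
  then show ?thesis
    using S by (simp add: s_def [abs_def])
qed

end

section \<open>The iterated series, by induction on the number of knots\<close>

lemma nested_sum_mult_left:
  fixes F :: "nat list \<Rightarrow> 'a::real_normed_algebra"
  assumes "nested_summable k F"
  shows "nested_summable k (\<lambda>ns. c * F ns) \<and> nested_sum k (\<lambda>ns. c * F ns) = c * nested_sum k F"
  using assms
\<comment> \<open>Both claims go through one induction: summability of the outer series concerns the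
  values of the inner sums, so it needs the equation one level down.\<close>
proof (induction k arbitrary: F)
  case 0
  then show ?case by simp
next
  case (Suc k)
  then show ?case
    by (auto simp: suminf_mult intro: summable_mult)
qed

text \<open>Fixing the first index leaves a term of the same kind with the shift raised by
  \<open>n\<close>. This is why the main induction keeps \<open>l\<close> arbitrary.\<close>

lemma G_term_Cons:
  "G_term g l (x # xs) (n # ns) = x ^ n * G_term g (n + l) xs ns"
  by (simp add: G_term_def prod.lessThan_Suc_shift add_ac mult_ac del: prod.lessThan_Suc)

lemma nested_sum_G_term:
  fixes g :: "nat \<Rightarrow> 'a::{real_normed_field, banach}"
  assumes conv: "\<And>z. norm z < R \<Longrightarrow> summable (\<lambda>n. g n * z ^ n)"
    and "xs \<noteq> []" "distinct xs" "\<forall>x\<in>set xs. norm x < R"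
  shows "nested_summable (length xs) (G_term g l xs) \<and>
         nested_sum (length xs) (G_term g l xs) =
           lagrange_sum (set xs) (\<lambda>z. z ^ (length xs - 1) * shifted_series g l z)"
  using assms(2-)
proof (induction xs arbitrary: l rule: list_nonempty_induct)
  case (single x)
  then have "(\<lambda>n. g (n + l) * x ^ n) sums shifted_series g l x"
    by (intro shifted_series_sums[OF conv]) auto
  then show ?case
    by (simp add: G_term_def lagrange_sum_def sums_iff)
next
  case (cons x xs)
  define k where "k = length xs - 1"
  have k: "length xs = Suc k" "card (set xs) = Suc k"
    using cons by (simp_all add: k_def distinct_card)
  have IH: "nested_summable (length xs) (G_term g m xs)"
    "nested_sum (length xs) (G_term g m xs) =
       lagrange_sum (set xs) (\<lambda>z. z ^ k * shifted_series g m z)" for m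
    using cons by (simp_all add: k_def)
  let ?F = "\<lambda>n. nested_sum (length xs) (\<lambda>ns. G_term g l (x # xs) (n # ns))"
  have F: "?F n = lagrange_sum (set xs) (\<lambda>z. z ^ k * (x ^ n * shifted_series g (n + l) z))" for n
    unfolding G_term_Cons
    using nested_sum_mult_left[OF IH(1), of "x ^ n"]
    by (simp add: IH(2) mult.left_commute flip: lagrange_sum_mult_left)
  \<comment> \<open>A Lagrange sum is finite, so the outer series may be evaluated at each knot
    \<open>z\<close> separately; distinctness gives \<open>x \<noteq> z\<close> for the two-knot
    formula.\<close>
  have "?F sums lagrange_sum (set xs)
          (\<lambda>z. z ^ k * ((x * shifted_series g l x - z * shifted_series g l z) / (x - z)))"
    unfolding F using cons.prems
    by (intro sums_lagrange_sum sums_mult sums_power_mult_shifted_series[OF conv]) auto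
  then have "?F sums lagrange_sum (set (x # xs)) (\<lambda>z. z ^ Suc k * shifted_series g l z)"
    using lagrange_sum_insert_power_mult[of "set xs" x k "shifted_series g l"] cons.prems k
    by simp
  moreover have "nested_summable (length xs) (\<lambda>ns. G_term g l (x # xs) (n # ns))" for n
    unfolding G_term_Cons using nested_sum_mult_left[OF IH(1)] by blast
  ultimately show ?case
    by (simp add: sums_iff k)
qed

theorem theorem1:
  fixes g :: "nat \<Rightarrow> 'a::{real_normed_field, banach}"
    and R :: real and k l :: nat and xs :: "'a list"
  assumes "R > 1"
    and "\<And>z. norm z < R \<Longrightarrow> summable (\<lambda>n. g n * z ^ n)"
    and "k \<ge> 1"
    and "length xs = k"
    and "distinct xs"
    and "\<forall>x\<in>set xs. norm x < R"
  shows "nested_summable k (G_term g l xs) \<and>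
         G g k l xs = divided_difference xs (\<lambda>z. z ^ (k - 1) * shifted_series g l z)"
proof -
  have "xs \<noteq> []"
    using assms(3,4) by auto
  then show ?thesis
    using nested_sum_G_term[OF assms(2), where xs = xs and l = l] assms(4-6)
    by (simp add: G_def divided_difference_eq_lagrange_sum)
qed

end
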